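(* Let $\mathcal T$ be the abstract cluster structure over the graph with one vertex $*$ and no arrows (whose signed path category is the terminal category $\mathbb 1$), given by $\mathcal X( * )=\{0\}$, $\mathcal A( * )=\{0\}$, $\beta_*=\mathrm{id}_{\{0\}}$ and the zero pairing $\langle 0,0\rangle_*=0$. Then $\mathcal T$ is terminal in the category $\mathbf{ACS}$ of abstract cluster structures.
   Context: Ab is the category of abelian groups; $A^*=\mathrm{Hom}_{\mathbb Z}(A,\mathbb Z)$. Signed path category. Let $E$ be a simple directed graph (no loops, at most one arrow with given source and target; 2-cycles allowed). $E_\pm$ has the same vertices and, for each arrow $\alpha\colon c\to d$ of $E$, two arrows $\alpha^+,\alpha^-\colon c\to d$. $\mathcal E(E)$ is the quotient of the path category of $E_\pm$ by the relations $\gamma^-\circ\alpha^+=\mathrm{id}_c$ and $\gamma^+\circ\alpha^-=\mathrm{id}_c$ whenever $\alpha\colon c\to d$ and $\gamma\colon d\to c$ are arrows of $E$. Pairing. For $F\colon\mathcal C\to\mathrm{Ab}$ and $G\colon\mathcal C^{op}\to\mathrm{Ab}$, a pairing $\langle-,-\rangle\colon F\otimes_{\mathbb Z}G\to\underline{\mathbb Z}$ is a dinatural transformation, i.e. a family of bilinear forms $\langle-,-\rangle_c\colon Fc\times Gc\to\mathbb Z$ with $\langle a,Gf(b)\rangle_c=\langle Ff(a),b\rangle_d$ for all $f\colon c\to d$, $a\in Fc$, $b\in Gd$. It is right non-degenerate if each $\delta_{Gc}\colon Gc\to (Fc)^*$, $b\mapsto\langle-,b\rangle_c$, is injective. A free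 abelian sheaf is a functor to Ab of the form $\mathrm{Free}_{\mathbb Z}\circ\mathcal B$ with $\mathcal B$ a Set-valued functor on the same domain. Abstract cluster structure over $E$: a tuple $(\mathcal E,\mathcal X,\beta,\mathcal A,\langle-,-\rangle)$ with $\mathcal E=\mathcal E(E)$, $\mathcal X\colon\mathcal E^{op}\to\mathrm{Ab}$ and $\mathcal A\colon\mathcal E\to\mathrm{Ab}$ free abelian sheaves, $\beta\colon\mathcal X\to\mathcal A$ a factorization (a family $\beta_c\colon\mathcal Xc\to\mathcal Ac$ with $\beta_d=\mathcal Af\circ\beta_c\circ\mathcal Xf$ for all $f\colon c\to d$ in $\mathcal E$), and $\langle-,-\rangle\colon\mathcal A\otimes_{\mathbb Z}\mathcal X\to\underline{\mathbb Z}$ a right non-degenerate pairing. A morphism in $\mathbf{ACS}$ from $(\mathcal E_1,\mathcal X_1,\beta_1,\mathcal A_1,\langle-,-\rangle^1)$ to $(\mathcal E_2,\mathcal X_2,\beta_2,\mathcal A_2,\langle-,-\rangle^2)$ is a tuple $(F,\chi,\alpha)$ with $F\colon\mathcal E_1\to\mathcal E_2$ a functor, $\chi\colon\mathcal X_1\to\mathcal X_2F^{op}$ and $\alpha\colon\mathcal A_1\to\mathcal A_2F$ natural transformations, such that $\alpha_c\circ(\beta_1)_c=(\beta_2)_{Fc}\circ\chi_c$ for all $c$. Composition is componentwise, with $(\chi'\circ\chi)_c=\chi'_{Fc}\circ\chi_c$ and $(\alpha'\circ\alpha)_c=\alpha'_{Fc}\circ\alpha_c$. *)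

theory Defs
  imports
    "HOL-Algebra.Free_Abelian_Groups"
    "Graph_Theory.Pair_Digraph"
begin

section \<open>Categories, functors and natural transformations\<close>

record ('o, 'm) precategory =
  Obj :: "'o set"
  Arr :: "'m set"
  Dom :: "'m \<Rightarrow> 'o"
  Cod :: "'m \<Rightarrow> 'o"
  Ident :: "'o \<Rightarrow> 'm"
  Comp :: "'m \<Rightarrow> 'm \<Rightarrow> 'm"  (infixl \<open>\<cdot>\<index>\<close> 70)

text \<open>\<open>g \<cdot>\<^bsub>C\<^esub> f\<close> is \<open>g\<close> after \<open>f\<close>.\<close>

locale category =
  fixes C :: "('o, 'm) precategory" (structure)
  assumes Dom_in: "f \<in> Arr C \<Longrightarrow> Dom C f \<in> Obj C"
    and Cod_in: "f \<in> Arr C \<Longrightarrow> Cod C f \<in> Obj C"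
    and Ident_in: "a \<in> Obj C \<Longrightarrow> Ident C a \<in> Arr C"
    and Dom_Ident: "a \<in> Obj C \<Longrightarrow> Dom C (Ident C a) = a"
    and Cod_Ident: "a \<in> Obj C \<Longrightarrow> Cod C (Ident C a) = a"
    and Comp_in: "\<lbrakk>f \<in> Arr C; g \<in> Arr C; Dom C g = Cod C f\<rbrakk> \<Longrightarrow> g \<cdot> f \<in> Arr C"
    and Dom_Comp: "\<lbrakk>f \<in> Arr C; g \<in> Arr C; Dom C g = Cod C f\<rbrakk> \<Longrightarrow> Dom C (g \<cdot> f) = Dom C f"
    and Cod_Comp: "\<lbrakk>f \<in> Arr C; g \<in> Arr C; Dom C g = Cod C f\<rbrakk> \<Longrightarrow> Cod C (g \<cdot> f) = Cod C g"
    and Comp_Ident: "f \<in> Arr C \<Longrightarrow> f \<cdot> Ident C (Dom C f) = f"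
    and Ident_Comp: "f \<in> Arr C \<Longrightarrow> Ident C (Cod C f) \<cdot> f = f"
    and Comp_assoc: "\<lbrakk>f \<in> Arr C; g \<in> Arr C; h \<in> Arr C; Dom C g = Cod C f; Dom C h = Cod C g\<rbrakk>
      \<Longrightarrow> (h \<cdot> g) \<cdot> f = h \<cdot> (g \<cdot> f)"

definition Hom :: "('o, 'm) precategory \<Rightarrow> 'o \<Rightarrow> 'o \<Rightarrow> 'm set" where
  "Hom C a b = {f \<in> Arr C. Dom C f = a \<and> Cod C f = b}"

definition terminal_object :: "('o, 'm) precategory \<Rightarrow> 'o \<Rightarrow> bool" where
  "terminal_object C t \<longleftrightarrow> t \<in> Obj C \<and> (\<forall>a \<in> Obj C. \<exists>!f. f \<in> Hom C a t)"

definition op_cat :: "('o, 'm) precategory \<Rightarrow> ('o, 'm) precategory" where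
  "op_cat C = \<lparr>Obj = Obj C, Arr = Arr C, Dom = Cod C, Cod = Dom C, Ident = Ident C,
     Comp = (\<lambda>g f. f \<cdot>\<^bsub>C\<^esub> g)\<rparr>"

record ('o1, 'm1, 'o2, 'm2) ftor =
  FObj :: "'o1 \<Rightarrow> 'o2"
  FArr :: "'m1 \<Rightarrow> 'm2"

text \<open>The object and arrow maps of a functor, and the families below, are required to be
  \<^const>\<open>undefined\<close> outside their mathematical domain, so that equality in HOL is the
  mathematical equality.\<close>

definition is_ftor ::
  "('o1, 'm1) precategory \<Rightarrow> ('o2, 'm2) precategory \<Rightarrow> ('o1, 'm1, 'o2, 'm2) ftor \<Rightarrow> bool" where
  "is_ftor C D F \<longleftrightarrow>
     FObj F \<in> Obj C \<rightarrow>\<^sub>E Obj D \<and>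
     FArr F \<in> Arr C \<rightarrow>\<^sub>E Arr D \<and>
     (\<forall>f \<in> Arr C. Dom D (FArr F f) = FObj F (Dom C f) \<and> Cod D (FArr F f) = FObj F (Cod C f)) \<and>
     (\<forall>a \<in> Obj C. FArr F (Ident C a) = Ident D (FObj F a)) \<and>
     (\<forall>f \<in> Arr C. \<forall>g \<in> Arr C. Dom C g = Cod C f \<longrightarrow>
        FArr F (g \<cdot>\<^bsub>C\<^esub> f) = FArr F g \<cdot>\<^bsub>D\<^esub> FArr F f)"

definition id_ftor :: "('o, 'm) precategory \<Rightarrow> ('o, 'm, 'o, 'm) ftor" where
  "id_ftor C = \<lparr>FObj = (\<lambda>a \<in> Obj C. a), FArr = (\<lambda>f \<in> Arr C. f)\<rparr>"

definition comp_ftor ::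
  "('o1, 'm1) precategory \<Rightarrow> ('o2, 'm2, 'o3, 'm3) ftor \<Rightarrow> ('o1, 'm1, 'o2, 'm2) ftor
     \<Rightarrow> ('o1, 'm1, 'o3, 'm3) ftor" where
  "comp_ftor C G F =
     \<lparr>FObj = (\<lambda>a \<in> Obj C. FObj G (FObj F a)), FArr = (\<lambda>f \<in> Arr C. FArr G (FArr F f))\<rparr>"

definition const_ftor ::
  "('o1, 'm1) precategory \<Rightarrow> ('o2, 'm2) precategory \<Rightarrow> 'o2 \<Rightarrow> ('o1, 'm1, 'o2, 'm2) ftor" where
  "const_ftor C D d = \<lparr>FObj = (\<lambda>a \<in> Obj C. d), FArr = (\<lambda>f \<in> Arr C. Ident D d)\<rparr>"

definition is_nat_trans ::
  "('o1, 'm1) precategory \<Rightarrow> ('o2, 'm2) precategory \<Rightarrow> ('o1, 'm1, 'o2, 'm2) ftor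
     \<Rightarrow> ('o1, 'm1, 'o2, 'm2) ftor \<Rightarrow> ('o1 \<Rightarrow> 'm2) \<Rightarrow> bool" where
  "is_nat_trans C D F G \<eta> \<longleftrightarrow>
     \<eta> \<in> (\<Pi>\<^sub>E a \<in> Obj C. Hom D (FObj F a) (FObj G a)) \<and>
     (\<forall>f \<in> Arr C. \<eta> (Cod C f) \<cdot>\<^bsub>D\<^esub> FArr F f = FArr G f \<cdot>\<^bsub>D\<^esub> \<eta> (Dom C f))"


section \<open>Sets, abelian groups and free abelian sheaves\<close>

text \<open>Arrows of the concrete categories are triples (domain, map, codomain).\<close>

definition fn :: "'x \<times> ('g \<Rightarrow> 'h) \<times> 'y \<Rightarrow> 'g \<Rightarrow> 'h" where
  "fn t = fst (snd t)"

definition Set_cat :: "('b set, 'b set \<times> ('b \<Rightarrow> 'b) \<times> 'b set) precategory" where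
  "Set_cat =
     \<lparr>Obj = UNIV,
      Arr = {(A, f, B). f \<in> A \<rightarrow>\<^sub>E B},
      Dom = fst,
      Cod = snd \<circ> snd,
      Ident = (\<lambda>A. (A, \<lambda>x \<in> A. x, A)),
      Comp = (\<lambda>g f. (fst f, compose (fst f) (fn g) (fn f), snd (snd g)))\<rparr>"

type_synonym 'g ab_arr = "'g monoid \<times> ('g \<Rightarrow> 'g) \<times> 'g monoid"

definition Ab :: "('g monoid, 'g ab_arr) precategory" where
  "Ab =
     \<lparr>Obj = {G. comm_group G},
      Arr = {(G, h, H). comm_group G \<and> comm_group H \<and>
               h \<in> hom G H \<and> h \<in> extensional (carrier G)},
      Dom = fst,
      Cod = snd \<circ> snd,
      Ident = (\<lambda>G. (G, \<lambda>x \<in> carrier G. x, G)),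
      Comp = (\<lambda>g f. (fst f, compose (carrier (fst f)) (fn g) (fn f), snd (snd g)))\<rparr>"

definition Free_ftor ::
  "('b set, 'b set \<times> ('b \<Rightarrow> 'b) \<times> 'b set, ('b \<Rightarrow>\<^sub>0 int) monoid, ('b \<Rightarrow>\<^sub>0 int) ab_arr) ftor" where
  "Free_ftor =
     \<lparr>FObj = free_Abelian_group,
      FArr = (\<lambda>t \<in> Arr Set_cat. case t of (A, f, B) \<Rightarrow>
        (free_Abelian_group A,
         \<lambda>x \<in> carrier (free_Abelian_group A). frag_extend (frag_of \<circ> f) x,
         free_Abelian_group B))\<rparr>"

definition free_abelian_sheaf ::
  "('o, 'm) precategory \<Rightarrow> ('o, 'm, ('b \<Rightarrow>\<^sub>0 int) monoid, ('b \<Rightarrow>\<^sub>0 int) ab_arr) ftor \<Rightarrow> bool" where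
  "free_abelian_sheaf C F \<longleftrightarrow> (\<exists>B. is_ftor C Set_cat B \<and> F = comp_ftor C Free_ftor B)"


section \<open>Signed path categories\<close>

text \<open>Paths carry their end points, so that there is an empty path at every vertex. Arc lists
  are in the order of traversal.\<close>

type_synonym ('v, 'e) path = "'v \<times> 'e list \<times> 'v"

definition path_cat :: "('v, 'e) pre_digraph \<Rightarrow> ('v, ('v, 'e) path) precategory" where
  "path_cat G =
     \<lparr>Obj = verts G,
      Arr = {(u, p, v). pre_digraph.awalk G u p v},
      Dom = fst,
      Cod = snd \<circ> snd,
      Ident = (\<lambda>v. (v, [], v)),
      Comp = (\<lambda>q p. (fst p, fst (snd p) @ fst (snd q), snd (snd q)))\<rparr>"

text \<open>The smallest congruence on the arrows of \<open>C\<close> containing \<open>R\<close>.\<close>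

inductive cat_cong :: "('o, 'm) precategory \<Rightarrow> ('m \<times> 'm) set \<Rightarrow> 'm \<Rightarrow> 'm \<Rightarrow> bool"
  for C :: "('o, 'm) precategory" and R :: "('m \<times> 'm) set" where
  base: "(f, g) \<in> R \<Longrightarrow> cat_cong C R f g"
| refl: "f \<in> Arr C \<Longrightarrow> cat_cong C R f f"
| sym: "cat_cong C R f g \<Longrightarrow> cat_cong C R g f"
| trans: "\<lbrakk>cat_cong C R f g; cat_cong C R g h\<rbrakk> \<Longrightarrow> cat_cong C R f h"
| comp: "\<lbrakk>cat_cong C R f f'; cat_cong C R g g'; Dom C g = Cod C f\<rbrakk>
    \<Longrightarrow> cat_cong C R (g \<cdot>\<^bsub>C\<^esub> f) (g' \<cdot>\<^bsub>C\<^esub> f')"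

definition cong_class :: "('o, 'm) precategory \<Rightarrow> ('m \<times> 'm) set \<Rightarrow> 'm \<Rightarrow> 'm set" where
  "cong_class C R f = {g. cat_cong C R f g}"

text \<open>Meaningful if \<open>R\<close> only relates parallel arrows of \<open>C\<close>; the end points of a class are then
  the common end points of its members.\<close>

definition quotient_cat ::
  "('o, 'm) precategory \<Rightarrow> ('m \<times> 'm) set \<Rightarrow> ('o, 'm set) precategory" where
  "quotient_cat C R =
     \<lparr>Obj = Obj C,
      Arr = cong_class C R ` Arr C,
      Dom = (\<lambda>P. the_elem (Dom C ` P)),
      Cod = (\<lambda>P. the_elem (Cod C ` P)),
      Ident = (\<lambda>a. cong_class C R (Ident C a)),
      Comp = (\<lambda>Q P. \<Union>g \<in> Q. \<Union>f \<in> {f \<in> P. Dom C g = Cod C f}. cong_class C R (g \<cdot>\<^bsub>C\<^esub> f))\<rparr>"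

text \<open>A simple directed graph is a \<^typ>\<open>'v pair_pre_digraph\<close> satisfying
  \<^const>\<open>pair_loopfree_digraph\<close>: arcs are pairs of vertices, there are no loops, and finiteness
  is not required.\<close>

datatype sign = Plus | Minus

type_synonym 'v sarc = "('v \<times> 'v) \<times> sign"

definition signed_graph :: "'v pair_pre_digraph \<Rightarrow> ('v, 'v sarc) pre_digraph" where
  "signed_graph E =
     \<lparr>verts = pverts E, arcs = parcs E \<times> UNIV, tail = fst \<circ> fst, head = snd \<circ> fst\<rparr>"

definition signed_rels ::
  "'v pair_pre_digraph \<Rightarrow> (('v, 'v sarc) path \<times> ('v, 'v sarc) path) set" where
  "signed_rels E =
     {((c, [((c, d), s), ((d, c), s')], c), (c, [], c)) | c d s s'.
        (c, d) \<in> parcs E \<and> (d, c) \<in> parcs E \<and> s \<noteq> s'}"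

type_synonym 'v spath_class = "('v, 'v sarc) path set"

definition signed_path_cat :: "'v pair_pre_digraph \<Rightarrow> ('v, 'v spath_class) precategory" where
  "signed_path_cat E = quotient_cat (path_cat (signed_graph E)) (signed_rels E)"


section \<open>Pairings and factorizations\<close>

definition is_pairing ::
  "('o, 'm) precategory \<Rightarrow> ('o, 'm, 'g monoid, 'g ab_arr) ftor \<Rightarrow> ('o, 'm, 'h monoid, 'h ab_arr) ftor
     \<Rightarrow> ('o \<Rightarrow> 'g \<times> 'h \<Rightarrow> int) \<Rightarrow> bool" where
  "is_pairing C F G pr \<longleftrightarrow>
     is_ftor C Ab F \<and> is_ftor (op_cat C) Ab G \<and>
     pr \<in> extensional (Obj C) \<and>
     (\<forall>c \<in> Obj C.
        pr c \<in> extensional (carrier (FObj F c) \<times> carrier (FObj G c)) \<and>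
        (\<forall>b \<in> carrier (FObj G c). (\<lambda>a. pr c (a, b)) \<in> hom (FObj F c) integer_group) \<and>
        (\<forall>a \<in> carrier (FObj F c). (\<lambda>b. pr c (a, b)) \<in> hom (FObj G c) integer_group)) \<and>
     (\<forall>c d. \<forall>f \<in> Hom C c d. \<forall>a \<in> carrier (FObj F c). \<forall>b \<in> carrier (FObj G d).
        pr c (a, fn (FArr G f) b) = pr d (fn (FArr F f) a, b))"

text \<open>\<open>pairing_delta F pr c\<close> is the map \<open>b \<mapsto> \<langle>-, b\<rangle>\<^sub>c\<close> from \<open>G c\<close> to the dual of \<open>F c\<close>.\<close>

definition pairing_delta ::
  "('o, 'm, 'g monoid, 'g ab_arr) ftor \<Rightarrow> ('o \<Rightarrow> 'g \<times> 'h \<Rightarrow> int) \<Rightarrow> 'o \<Rightarrow> 'h \<Rightarrow> 'g \<Rightarrow> int" where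
  "pairing_delta F pr c b = (\<lambda>a \<in> carrier (FObj F c). pr c (a, b))"

definition right_nondegenerate ::
  "('o, 'm) precategory \<Rightarrow> ('o, 'm, 'g monoid, 'g ab_arr) ftor \<Rightarrow> ('o, 'm, 'h monoid, 'h ab_arr) ftor
     \<Rightarrow> ('o \<Rightarrow> 'g \<times> 'h \<Rightarrow> int) \<Rightarrow> bool" where
  "right_nondegenerate C F G pr \<longleftrightarrow>
     (\<forall>c \<in> Obj C. inj_on (pairing_delta F pr c) (carrier (FObj G c)))"

definition is_factorization ::
  "('o, 'm) precategory \<Rightarrow> ('o, 'm, 'g monoid, 'g ab_arr) ftor \<Rightarrow> ('o, 'm, 'g monoid, 'g ab_arr) ftor
     \<Rightarrow> ('o \<Rightarrow> 'g ab_arr) \<Rightarrow> bool" where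
  "is_factorization C X A \<beta> \<longleftrightarrow>
     \<beta> \<in> (\<Pi>\<^sub>E c \<in> Obj C. Hom Ab (FObj X c) (FObj A c)) \<and>
     (\<forall>c d. \<forall>f \<in> Hom C c d. \<beta> d = FArr A f \<cdot>\<^bsub>Ab\<^esub> \<beta> c \<cdot>\<^bsub>Ab\<^esub> FArr X f)"


section \<open>Abstract cluster structures\<close>

text \<open>The type variables \<open>'v\<close> (vertices) and \<open>'b\<close> (elements of the sets generating the free
  groups) bound the size of the structures considered; they play the role of a universe.\<close>

record ('v, 'b) cluster_data =
  cEE :: "('v, 'v spath_class) precategory"
  cX :: "('v, 'v spath_class, ('b \<Rightarrow>\<^sub>0 int) monoid, ('b \<Rightarrow>\<^sub>0 int) ab_arr) ftor"
  cbeta :: "'v \<Rightarrow> ('b \<Rightarrow>\<^sub>0 int) ab_arr"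
  cA :: "('v, 'v spath_class, ('b \<Rightarrow>\<^sub>0 int) monoid, ('b \<Rightarrow>\<^sub>0 int) ab_arr) ftor"
  cpair :: "'v \<Rightarrow> ('b \<Rightarrow>\<^sub>0 int) \<times> ('b \<Rightarrow>\<^sub>0 int) \<Rightarrow> int"

definition abstract_cluster_structure_over ::
  "'v pair_pre_digraph \<Rightarrow> ('v, 'b) cluster_data \<Rightarrow> bool" where
  "abstract_cluster_structure_over E S \<longleftrightarrow>
     pair_loopfree_digraph E \<and>
     cEE S = signed_path_cat E \<and>
     is_ftor (op_cat (cEE S)) Ab (cX S) \<and> free_abelian_sheaf (op_cat (cEE S)) (cX S) \<and>
     is_ftor (cEE S) Ab (cA S) \<and> free_abelian_sheaf (cEE S) (cA S) \<and>
     is_factorization (cEE S) (cX S) (cA S) (cbeta S) \<and>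
     is_pairing (cEE S) (cA S) (cX S) (cpair S) \<and>
     right_nondegenerate (cEE S) (cA S) (cX S) (cpair S)"

record ('v, 'b) cluster_mor =
  mF :: "('v, 'v spath_class, 'v, 'v spath_class) ftor"
  mchi :: "'v \<Rightarrow> ('b \<Rightarrow>\<^sub>0 int) ab_arr"
  malpha :: "'v \<Rightarrow> ('b \<Rightarrow>\<^sub>0 int) ab_arr"

text \<open>The opposite of a functor has the same underlying maps, so it is denoted by the functor
  itself.\<close>

definition is_cluster_mor ::
  "('v, 'b) cluster_data \<Rightarrow> ('v, 'b) cluster_data \<Rightarrow> ('v, 'b) cluster_mor \<Rightarrow> bool" where
  "is_cluster_mor S1 S2 m \<longleftrightarrow>
     is_ftor (cEE S1) (cEE S2) (mF m) \<and>
     is_nat_trans (op_cat (cEE S1)) Ab (cX S1)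
       (comp_ftor (op_cat (cEE S1)) (cX S2) (mF m)) (mchi m) \<and>
     is_nat_trans (cEE S1) Ab (cA S1) (comp_ftor (cEE S1) (cA S2) (mF m)) (malpha m) \<and>
     (\<forall>c \<in> Obj (cEE S1).
        malpha m c \<cdot>\<^bsub>Ab\<^esub> cbeta S1 c = cbeta S2 (FObj (mF m) c) \<cdot>\<^bsub>Ab\<^esub> mchi m c)"

definition id_cluster_mor :: "('v, 'b) cluster_data \<Rightarrow> ('v, 'b) cluster_mor" where
  "id_cluster_mor S =
     \<lparr>mF = id_ftor (cEE S),
      mchi = (\<lambda>c \<in> Obj (cEE S). Ident Ab (FObj (cX S) c)),
      malpha = (\<lambda>c \<in> Obj (cEE S). Ident Ab (FObj (cA S) c))\<rparr>"

definition comp_cluster_mor ::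
  "('v, 'b) cluster_data \<Rightarrow> ('v, 'b) cluster_mor \<Rightarrow> ('v, 'b) cluster_mor
     \<Rightarrow> ('v, 'b) cluster_mor" where
  "comp_cluster_mor S1 n m =
     \<lparr>mF = comp_ftor (cEE S1) (mF n) (mF m),
      mchi = (\<lambda>c \<in> Obj (cEE S1). mchi n (FObj (mF m) c) \<cdot>\<^bsub>Ab\<^esub> mchi m c),
      malpha = (\<lambda>c \<in> Obj (cEE S1). malpha n (FObj (mF m) c) \<cdot>\<^bsub>Ab\<^esub> malpha m c)\<rparr>"

definition ACS ::
  "(('v, 'b) cluster_data,
    ('v, 'b) cluster_data \<times> ('v, 'b) cluster_mor \<times> ('v, 'b) cluster_data) precategory" where
  "ACS =
     \<lparr>Obj = {S. \<exists>E. abstract_cluster_structure_over E S},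
      Arr = {(S1, m, S2). (\<exists>E. abstract_cluster_structure_over E S1) \<and>
               (\<exists>E. abstract_cluster_structure_over E S2) \<and> is_cluster_mor S1 S2 m},
      Dom = fst,
      Cod = snd \<circ> snd,
      Ident = (\<lambda>S. (S, id_cluster_mor S, S)),
      Comp = (\<lambda>n m. (fst m, comp_cluster_mor (fst m) (fst (snd n)) (fst (snd m)), snd (snd n)))\<rparr>"


section \<open>The structure with zero groups over a one-vertex graph\<close>

definition zero_group :: "('b \<Rightarrow>\<^sub>0 int) monoid" where
  "zero_group = \<lparr>carrier = {0}, monoid.mult = (+), one = 0\<rparr>"

definition point_graph :: "'v \<Rightarrow> 'v pair_pre_digraph" where
  "point_graph v = \<lparr>pverts = {v}, parcs = {}\<rparr>"

definition trivial_cluster_structure :: "'v \<Rightarrow> ('v, 'b) cluster_data" where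
  "trivial_cluster_structure v =
     (let EE = signed_path_cat (point_graph v) in
     \<lparr>cEE = EE,
      cX = const_ftor (op_cat EE) Ab zero_group,
      cbeta = (\<lambda>c \<in> {v}. Ident Ab zero_group),
      cA = const_ftor EE Ab zero_group,
      cpair = (\<lambda>c \<in> {v}. \<lambda>x \<in> {0} \<times> {0}. 0)\<rparr>)"


section \<open>The abstract cluster structures form a category\<close>

lemma op_cat_simps [simp]:
  "Obj (op_cat C) = Obj C" "Arr (op_cat C) = Arr C" "Dom (op_cat C) = Cod C"
  "Cod (op_cat C) = Dom C" "Ident (op_cat C) = Ident C" "Comp (op_cat C) = (\<lambda>g f. f \<cdot>\<^bsub>C\<^esub> g)"
  by (simp_all add: op_cat_def)

lemma category_op_cat:
  assumes "category C"
  shows "category (op_cat C)"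
proof -
  interpret category C by fact
  show ?thesis
    by unfold_locales (auto simp: Dom_in Cod_in Ident_in Dom_Ident Cod_Ident Comp_in Dom_Comp
        Cod_Comp Comp_Ident Ident_Comp Comp_assoc)
qed

lemma category_Set_cat: "category Set_cat"
proof unfold_locales
  fix f :: "'a set \<times> ('a \<Rightarrow> 'a) \<times> 'a set"
  assume f: "f \<in> Arr Set_cat"
  show "f \<cdot>\<^bsub>Set_cat\<^esub> Ident Set_cat (Dom Set_cat f) = f"
    using f by (auto simp: Set_cat_def fn_def PiE_def compose_Id)
  show "Ident Set_cat (Cod Set_cat f) \<cdot>\<^bsub>Set_cat\<^esub> f = f"
    using f by (auto simp: Set_cat_def fn_def PiE_def Id_compose)
next
  fix f g h :: "'a set \<times> ('a \<Rightarrow> 'a) \<times> 'a set"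
  assume "f \<in> Arr Set_cat" "g \<in> Arr Set_cat" "h \<in> Arr Set_cat"
    "Dom Set_cat g = Cod Set_cat f" "Dom Set_cat h = Cod Set_cat g"
  then show "h \<cdot>\<^bsub>Set_cat\<^esub> g \<cdot>\<^bsub>Set_cat\<^esub> f = h \<cdot>\<^bsub>Set_cat\<^esub> (g \<cdot>\<^bsub>Set_cat\<^esub> f)"
    by (auto simp: Set_cat_def fn_def compose_def fun_eq_iff PiE_iff)
qed (auto simp: Set_cat_def fn_def compose_def PiE_iff)

lemma category_Ab: "category Ab"
proof unfold_locales
  fix f g :: "'a ab_arr"
  assume *: "f \<in> Arr Ab" "g \<in> Arr Ab" "Dom Ab g = Cod Ab f"
  obtain A p B where f: "f = (A, p, B)" by (cases f)
  obtain B' q D where g: "g = (B', q, D)" by (cases g)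
  have "group A" "p \<in> hom A B" "q \<in> hom B D"
    using * unfolding f g by (auto simp: Ab_def comm_group_def)
  then have "compose (carrier A) q p \<in> hom A D"
    by (rule group.hom_compose)
  then show "g \<cdot>\<^bsub>Ab\<^esub> f \<in> Arr Ab"
    using * unfolding f g by (auto simp: Ab_def fn_def)
next
  fix a :: "'a monoid"
  assume "a \<in> Obj Ab"
  then show "Ident Ab a \<in> Arr Ab"
    by (auto simp: Ab_def hom_def comm_group_def group_def intro: monoid.m_closed)
next
  fix f :: "'a ab_arr"
  assume f: "f \<in> Arr Ab"
  show "f \<cdot>\<^bsub>Ab\<^esub> Ident Ab (Dom Ab f) = f"
    using f by (auto simp: Ab_def fn_def compose_def extensional_def fun_eq_iff)
  show "Ident Ab (Cod Ab f) \<cdot>\<^bsub>Ab\<^esub> f = f"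
    using f by (auto simp: Ab_def fn_def compose_def extensional_def fun_eq_iff hom_def)
next
  fix f g h :: "'a ab_arr"
  assume "f \<in> Arr Ab" "g \<in> Arr Ab" "h \<in> Arr Ab" "Dom Ab g = Cod Ab f" "Dom Ab h = Cod Ab g"
  then show "h \<cdot>\<^bsub>Ab\<^esub> g \<cdot>\<^bsub>Ab\<^esub> f = h \<cdot>\<^bsub>Ab\<^esub> (g \<cdot>\<^bsub>Ab\<^esub> f)"
    by (auto simp: Ab_def fn_def compose_def fun_eq_iff hom_def)
qed (auto simp: Ab_def)

lemma is_ftor_Free: "is_ftor Set_cat Ab Free_ftor"
proof -
  let ?F = free_Abelian_group
  have closed: "frag_extend (frag_of \<circ> f) x \<in> carrier (?F B)"
    if "f \<in> A \<rightarrow> B" "x \<in> carrier (?F A)" for f :: "'a \<Rightarrow> 'a" and A B x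
    using that keys_frag_extend[of "frag_of \<circ> f" x]
    by (fastforce simp: free_Abelian_group_def)
  have hom: "(\<lambda>x \<in> carrier (?F A). frag_extend (frag_of \<circ> f) x) \<in> hom (?F A) (?F B)"
    if "f \<in> A \<rightarrow>\<^sub>E B" for f :: "'a \<Rightarrow> 'a" and A B
  proof (rule homI)
    fix x y
    assume xy: "x \<in> carrier (?F A)" "y \<in> carrier (?F A)"
    then have "x + y \<in> carrier (?F A)"
      using keys_add[of x y] by (auto simp: free_Abelian_group_def)
    then show "(\<lambda>x \<in> carrier (?F A). frag_extend (frag_of \<circ> f) x) (x \<otimes>\<^bsub>?F A\<^esub> y) =
      (\<lambda>x \<in> carrier (?F A). frag_extend (frag_of \<circ> f) x) x \<otimes>\<^bsub>?F B\<^esub>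
      (\<lambda>x \<in> carrier (?F A). frag_extend (frag_of \<circ> f) x) y"
      using xy by (simp add: free_Abelian_group_def frag_extend_add)
  qed (use closed[of f A B] that in \<open>auto simp: PiE_def\<close>)
  have ident: "frag_extend (frag_of \<circ> (\<lambda>x \<in> A. x)) c = c"
    if "c \<in> carrier (?F A)" for c and A :: "'a set"
  proof -
    have "frag_extend (frag_of \<circ> (\<lambda>x \<in> A. x)) c = frag_extend frag_of c"
      using that by (intro frag_extend_eq) (auto simp: free_Abelian_group_def)
    then show ?thesis using frag_expansion[of c] by simp
  qed
  have comp: "frag_extend (frag_of \<circ> compose A g f) c =
      frag_extend (frag_of \<circ> g) (frag_extend (frag_of \<circ> f) c)"
    if "c \<in> carrier (?F A)" for c and A :: "'a set" and f g :: "'a \<Rightarrow> 'a"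
    unfolding frag_extend_compose
    using that by (intro frag_extend_eq) (auto simp: free_Abelian_group_def compose_def)
  show ?thesis
    unfolding is_ftor_def
  proof (intro conjI ballI impI)
    show "FArr Free_ftor \<in> (Arr Set_cat :: ('a set \<times> ('a \<Rightarrow> 'a) \<times> 'a set) set) \<rightarrow>\<^sub>E Arr Ab"
    proof (rule PiE_I)
      fix t :: "'a set \<times> ('a \<Rightarrow> 'a) \<times> 'a set"
      assume t: "t \<in> Arr Set_cat"
      then show "FArr Free_ftor t \<in> Arr Ab"
        by (cases t) (simp add: Free_ftor_def Set_cat_def Ab_def abelian_free_Abelian_group hom)
    qed (simp add: Free_ftor_def)
    show "FObj Free_ftor \<in> (Obj Set_cat :: 'a set set) \<rightarrow>\<^sub>E Obj Ab"
      by (auto simp: Free_ftor_def Set_cat_def Ab_def abelian_free_Abelian_group)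
  next
    fix f :: "'a set \<times> ('a \<Rightarrow> 'a) \<times> 'a set"
    assume f: "f \<in> Arr Set_cat"
    show "Dom Ab (FArr Free_ftor f) = FObj Free_ftor (Dom Set_cat f)"
      "Cod Ab (FArr Free_ftor f) = FObj Free_ftor (Cod Set_cat f)"
      using f by (auto simp: Free_ftor_def Set_cat_def Ab_def)
    fix g :: "'a set \<times> ('a \<Rightarrow> 'a) \<times> 'a set"
    assume g: "g \<in> Arr Set_cat" and eq: "Dom Set_cat g = Cod Set_cat f"
    obtain A p B where f': "f = (A, p, B)" by (cases f)
    obtain B' q D where g': "g = (B', q, D)" by (cases g)
    have pq: "p \<in> A \<rightarrow> B" "g \<cdot>\<^bsub>Set_cat\<^esub> f \<in> Arr Set_cat" "B' = B"
      using category.Comp_in[OF category_Set_cat f g eq] f eq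
      unfolding f' g' by (auto simp: Set_cat_def)
    have "FArr Free_ftor (g \<cdot>\<^bsub>Set_cat\<^esub> f) = (?F A,
        \<lambda>x \<in> carrier (?F A). frag_extend (frag_of \<circ> compose A q p) x, ?F D)"
      using pq(2) unfolding f' g' by (simp add: Free_ftor_def) (simp add: Set_cat_def fn_def)
    also have "\<dots> = FArr Free_ftor g \<cdot>\<^bsub>Ab\<^esub> FArr Free_ftor f"
      using f g closed[OF pq(1)] unfolding f' g' pq(3)
      by (simp add: Free_ftor_def Ab_def fn_def compose_def[of "carrier _"] comp fun_eq_iff)
    finally show "FArr Free_ftor (g \<cdot>\<^bsub>Set_cat\<^esub> f) = FArr Free_ftor g \<cdot>\<^bsub>Ab\<^esub> FArr Free_ftor f" .
  next
    fix A :: "'a set"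
    have "Ident Set_cat A \<in> Arr Set_cat"
      by (auto simp: Set_cat_def)
    then show "FArr Free_ftor (Ident Set_cat A) = Ident Ab (FObj Free_ftor A)"
      by (simp add: Free_ftor_def Ab_def) (simp add: Set_cat_def ident fun_eq_iff)
  qed
qed

lemma category_path_cat:
  assumes "wf_digraph G"
  shows "category (path_cat G)"
proof -
  interpret wf_digraph G by fact
  show ?thesis
  proof unfold_locales
    fix f g :: "('a, 'b) path"
    assume *: "f \<in> Arr (path_cat G)" "g \<in> Arr (path_cat G)"
      "Dom (path_cat G) g = Cod (path_cat G) f"
    obtain u p v where f: "f = (u, p, v)" by (cases f)
    obtain v' q w where g: "g = (v', q, w)" by (cases g)
    have "awalk u (p @ q) w"
      using * unfolding f g by (intro awalk_appendI[where v = v]) (simp_all add: path_cat_def)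
    then show "g \<cdot>\<^bsub>path_cat G\<^esub> f \<in> Arr (path_cat G)"
      unfolding f g by (simp add: path_cat_def)
  next
    fix f :: "('a, 'b) path"
    assume f: "f \<in> Arr (path_cat G)"
    obtain u p v where f': "f = (u, p, v)" by (cases f)
    have "awalk u p v"
      using f unfolding f' by (simp add: path_cat_def)
    then show "Dom (path_cat G) f \<in> Obj (path_cat G)" "Cod (path_cat G) f \<in> Obj (path_cat G)"
      unfolding f' by (auto simp: path_cat_def dest: awalk_hd_in_verts awalk_last_in_verts)
  qed (simp_all add: path_cat_def awalk_Nil_iff split: prod.splits)
qed

locale category_rel = category C for C :: "('o, 'm) precategory" +
  fixes R :: "('m \<times> 'm) set"
  assumes parallel: "(f, g) \<in> R \<Longrightarrow> f \<in> Arr C \<and> g \<in> Arr C \<and> Dom C f = Dom C g \<and> Cod C f = Cod C g"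
begin

abbreviation "cls \<equiv> cong_class C R"
abbreviation "Q \<equiv> quotient_cat C R"

lemma cong_parallel:
  "cat_cong C R f g \<Longrightarrow> f \<in> Arr C \<and> g \<in> Arr C \<and> Dom C f = Dom C g \<and> Cod C f = Cod C g"
  by (induction rule: cat_cong.induct) (auto simp: parallel Comp_in Dom_Comp Cod_Comp)

lemma cls_eq: "cat_cong C R f g \<Longrightarrow> cls f = cls g"
  by (auto simp: cong_class_def intro: cat_cong.trans cat_cong.sym)

lemma Dom_Q: "f \<in> Arr C \<Longrightarrow> Dom Q (cls f) = Dom C f"
  and Cod_Q: "f \<in> Arr C \<Longrightarrow> Cod Q (cls f) = Cod C f"
proof -
  assume f: "f \<in> Arr C"
  have "Dom C ` cls f = {Dom C f}" "Cod C ` cls f = {Cod C f}"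
    using cat_cong.refl[OF f] cong_parallel by (auto simp: cong_class_def)
  then show "Dom Q (cls f) = Dom C f" "Cod Q (cls f) = Cod C f"
    by (simp_all add: quotient_cat_def)
qed

lemma Comp_Q:
  assumes f: "f \<in> Arr C" and g: "g \<in> Arr C" and fg: "Dom C g = Cod C f"
  shows "cls g \<cdot>\<^bsub>Q\<^esub> cls f = cls (g \<cdot>\<^bsub>C\<^esub> f)"
proof -
  have "cls (g' \<cdot>\<^bsub>C\<^esub> f') = cls (g \<cdot>\<^bsub>C\<^esub> f)" if "f' \<in> cls f" "g' \<in> cls g" for f' g'
    using that fg cong_parallel
    by (intro cls_eq[symmetric] cat_cong.comp) (auto simp: cong_class_def)
  moreover have "f \<in> cls f" "g \<in> cls g"
    using f g by (auto simp: cong_class_def intro: cat_cong.refl)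
  moreover have "cls g \<cdot>\<^bsub>Q\<^esub> cls f =
      (\<Union>g' \<in> cls g. \<Union>f' \<in> {f' \<in> cls f. Dom C g' = Cod C f'}. cls (g' \<cdot>\<^bsub>C\<^esub> f'))"
    by (simp add: quotient_cat_def)
  ultimately show ?thesis
    using fg by blast
qed

lemma category_quotient: "category Q"
proof -
  have Q: "Obj Q = Obj C" "Arr Q = cls ` Arr C" "Ident Q = (\<lambda>a. cls (Ident C a))"
    by (simp_all add: quotient_cat_def)
  have rep: "\<exists>p \<in> Arr C. f = cls p \<and> Dom Q f = Dom C p \<and> Cod Q f = Cod C p" if "f \<in> Arr Q" for f
    using that by (auto simp: Q Dom_Q Cod_Q)
  show ?thesis
  proof
    fix a
    assume "a \<in> Obj Q"
    then show "Ident Q a \<in> Arr Q" "Dom Q (Ident Q a) = a" "Cod Q (Ident Q a) = a"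
      by (simp_all add: Q Dom_Q Cod_Q Ident_in Dom_Ident Cod_Ident)
  next
    fix f
    assume "f \<in> Arr Q"
    then obtain p where p: "p \<in> Arr C" "f = cls p" "Dom Q f = Dom C p" "Cod Q f = Cod C p"
      using rep by blast
    show "Dom Q f \<in> Obj Q" "Cod Q f \<in> Obj Q"
      using p by (simp_all add: Q Dom_in Cod_in)
    show "f \<cdot>\<^bsub>Q\<^esub> Ident Q (Dom Q f) = f" "Ident Q (Cod Q f) \<cdot>\<^bsub>Q\<^esub> f = f"
      using p by (simp_all add: Q Comp_Q Dom_in Cod_in Ident_in Dom_Ident Cod_Ident Comp_Ident
          Ident_Comp)
    fix g
    assume "g \<in> Arr Q" and gf: "Dom Q g = Cod Q f"
    then obtain q where q: "q \<in> Arr C" "g = cls q" "Dom Q g = Dom C q" "Cod Q g = Cod C q"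
      using rep by blast
    have qp: "Dom C q = Cod C p"
      using gf p q by simp
    have comp: "g \<cdot>\<^bsub>Q\<^esub> f = cls (q \<cdot>\<^bsub>C\<^esub> p)"
      unfolding p(2) q(2) by (rule Comp_Q[OF p(1) q(1) qp])
    show "g \<cdot>\<^bsub>Q\<^esub> f \<in> Arr Q"
      unfolding comp using Comp_in[OF p(1) q(1) qp] by (simp add: Q)
    show "Dom Q (g \<cdot>\<^bsub>Q\<^esub> f) = Dom Q f" "Cod Q (g \<cdot>\<^bsub>Q\<^esub> f) = Cod Q g"
      unfolding comp p(3) q(4) Dom_Q[OF Comp_in[OF p(1) q(1) qp]] Cod_Q[OF Comp_in[OF p(1) q(1) qp]]
      by (rule Dom_Comp[OF p(1) q(1) qp] Cod_Comp[OF p(1) q(1) qp])+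
    fix h
    assume "h \<in> Arr Q" and hg: "Dom Q h = Cod Q g"
    then obtain r where r: "r \<in> Arr C" "h = cls r" "Dom Q h = Dom C r"
      using rep by blast
    have rq: "Dom C r = Cod C q"
      using hg q r by simp
    show "h \<cdot>\<^bsub>Q\<^esub> g \<cdot>\<^bsub>Q\<^esub> f = h \<cdot>\<^bsub>Q\<^esub> (g \<cdot>\<^bsub>Q\<^esub> f)"
      unfolding p(2) q(2) r(2) using p(1) q(1) r(1) qp rq
      by (simp add: Comp_Q Comp_in Dom_Comp Cod_Comp Comp_assoc)
  qed
qed

end

lemma category_signed_path_cat:
  assumes "pair_wf_digraph E"
  shows "category (signed_path_cat E)"
proof -
  interpret E: pair_wf_digraph E by fact
  have wf: "wf_digraph (signed_graph E)"
    by unfold_locales (auto simp: signed_graph_def E.in_arcsD1 E.in_arcsD2)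
  interpret category "path_cat (signed_graph E)"
    using wf by (rule category_path_cat)
  interpret category_rel "path_cat (signed_graph E)" "signed_rels E"
    by unfold_locales
      (auto simp: signed_rels_def path_cat_def signed_graph_def pre_digraph.awalk_def
        pre_digraph.cas.simps E.in_arcsD1 E.in_arcsD2)
  show ?thesis
    unfolding signed_path_cat_def by (rule category_quotient)
qed

lemma signed_path_cat_point_graph:
  "Obj (signed_path_cat (point_graph v)) = {v}" (is ?obj)
  "\<exists>a. Arr (signed_path_cat (point_graph v)) = {a}" (is ?arr)
proof -
  have "Arr (path_cat (signed_graph (point_graph v))) = {(v, [], v)}"
    by (auto simp: path_cat_def pre_digraph.awalk_def signed_graph_def point_graph_def
        pre_digraph.cas.simps)
  then show ?arr
    by (simp add: signed_path_cat_def quotient_cat_def)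
  show ?obj
    by (simp add: signed_path_cat_def quotient_cat_def path_cat_def signed_graph_def point_graph_def)
qed

lemma is_ftor_id: "category C \<Longrightarrow> is_ftor C C (id_ftor C)"
  by (auto simp: is_ftor_def id_ftor_def category.Dom_in category.Cod_in category.Ident_in
      category.Comp_in)

lemma is_ftor_comp:
  assumes "category C" and F: "is_ftor C D F" and G: "is_ftor D D' G"
  shows "is_ftor C D' (comp_ftor C G F)"
proof -
  interpret category C by fact
  have "FArr F f \<in> Arr D" if "f \<in> Arr C" for f
    using F that by (auto simp: is_ftor_def)
  moreover have "FObj F a \<in> Obj D" if "a \<in> Obj C" for a
    using F that by (auto simp: is_ftor_def)
  ultimately show ?thesis
    using F G by (auto simp: is_ftor_def comp_ftor_def Dom_in Cod_in Ident_in Comp_in PiE_mem)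
qed

lemma is_ftor_op: "is_ftor C D F \<Longrightarrow> is_ftor (op_cat C) (op_cat D) F"
  by (auto simp: is_ftor_def)

lemma comp_ftor_op [simp]: "comp_ftor (op_cat C) = comp_ftor C"
  by (simp add: comp_ftor_def fun_eq_iff)

lemma is_nat_trans_id:
  assumes "category C" "category D" and F: "is_ftor C D F"
  shows "is_nat_trans C D F (comp_ftor C F (id_ftor C)) (\<lambda>c \<in> Obj C. Ident D (FObj F c))"
proof -
  interpret C: category C by fact
  interpret D: category D by fact
  have a: "FObj F c \<in> Obj D" if "c \<in> Obj C" for c
    using F that by (auto simp: is_ftor_def)
  have f: "FArr F f \<in> Arr D" "FObj F (Dom C f) = Dom D (FArr F f)"
      "FObj F (Cod C f) = Cod D (FArr F f)" if "f \<in> Arr C" for f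
    using F that by (auto simp: is_ftor_def)
  show ?thesis
    by (auto simp: is_nat_trans_def Hom_def comp_ftor_def id_ftor_def a f C.Dom_in C.Cod_in
        D.Ident_in D.Dom_Ident D.Cod_Ident D.Comp_Ident D.Ident_Comp)
qed

lemma is_nat_trans_comp:
  assumes "category C" "category A"
    and K: "is_ftor C D K" and L: "is_ftor D D' L"
    and X1: "is_ftor C A X1" and X2: "is_ftor D A X2" and X3: "is_ftor D' A X3"
    and x: "is_nat_trans C A X1 (comp_ftor C X2 K) x"
    and y: "is_nat_trans D A X2 (comp_ftor D X3 L) y"
  shows "is_nat_trans C A X1 (comp_ftor C X3 (comp_ftor C L K))
    (\<lambda>c \<in> Obj C. y (FObj K c) \<cdot>\<^bsub>A\<^esub> x c)"
proof -
  interpret C: category C by fact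
  interpret A: category A by fact
  have Kc: "FObj K c \<in> Obj D" if "c \<in> Obj C" for c
    using K that by (auto simp: is_ftor_def)
  have Kf: "FArr K f \<in> Arr D" "Dom D (FArr K f) = FObj K (Dom C f)"
    "Cod D (FArr K f) = FObj K (Cod C f)" if "f \<in> Arr C" for f
    using K that by (auto simp: is_ftor_def)
  have xc: "x c \<in> Arr A" "Dom A (x c) = FObj X1 c" "Cod A (x c) = FObj X2 (FObj K c)"
    if "c \<in> Obj C" for c
    using PiE_mem[OF conjunct1[OF x[unfolded is_nat_trans_def]] that] that
    by (auto simp: Hom_def comp_ftor_def)
  have yc: "y c \<in> Arr A" "Dom A (y c) = FObj X2 c" "Cod A (y c) = FObj X3 (FObj L c)"
    if "c \<in> Obj D" for c
    using PiE_mem[OF conjunct1[OF y[unfolded is_nat_trans_def]] that] that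
    by (auto simp: Hom_def comp_ftor_def)
  have ftor: "FArr X f \<in> Arr A" "Dom A (FArr X f) = FObj X (Dom B f)"
    "Cod A (FArr X f) = FObj X (Cod B f)" if "is_ftor B A X" "f \<in> Arr B" for X f and B :: "('x, 'y) precategory"
    using that by (auto simp: is_ftor_def)
  have Lf: "FArr L f \<in> Arr D'" "Dom D' (FArr L f) = FObj L (Dom D f)"
    "Cod D' (FArr L f) = FObj L (Cod D f)" if "f \<in> Arr D" for f
    using L that by (auto simp: is_ftor_def)
  have "y (FObj K (Cod C f)) \<cdot>\<^bsub>A\<^esub> x (Cod C f) \<cdot>\<^bsub>A\<^esub> FArr X1 f =
      FArr X3 (FArr L (FArr K f)) \<cdot>\<^bsub>A\<^esub> (y (FObj K (Dom C f)) \<cdot>\<^bsub>A\<^esub> x (Dom C f))"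
    if f: "f \<in> Arr C" for f
  proof -
    note dc = C.Dom_in[OF f] C.Cod_in[OF f]
    note Kdc = Kc[OF dc(1)] Kc[OF dc(2)]
    have nx: "x (Cod C f) \<cdot>\<^bsub>A\<^esub> FArr X1 f = FArr X2 (FArr K f) \<cdot>\<^bsub>A\<^esub> x (Dom C f)"
      using x f by (auto simp: is_nat_trans_def comp_ftor_def)
    have ny: "y (FObj K (Cod C f)) \<cdot>\<^bsub>A\<^esub> FArr X2 (FArr K f) =
        FArr X3 (FArr L (FArr K f)) \<cdot>\<^bsub>A\<^esub> y (FObj K (Dom C f))"
      using y Kf[OF f] by (auto simp: is_nat_trans_def comp_ftor_def)
    note props = f dc Kdc xc[OF dc(1)] xc[OF dc(2)] yc[OF Kdc(1)] yc[OF Kdc(2)] ftor[OF X1 f]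
      ftor[OF X2 Kf(1)[OF f]] ftor[OF X3 Lf(1)[OF Kf(1)[OF f]]] Kf[OF f] Lf[OF Kf(1)[OF f]]
    have "y (FObj K (Cod C f)) \<cdot>\<^bsub>A\<^esub> x (Cod C f) \<cdot>\<^bsub>A\<^esub> FArr X1 f =
        y (FObj K (Cod C f)) \<cdot>\<^bsub>A\<^esub> (FArr X2 (FArr K f) \<cdot>\<^bsub>A\<^esub> x (Dom C f))"
      by (simp add: A.Comp_assoc props nx)
    also have "\<dots> = FArr X3 (FArr L (FArr K f)) \<cdot>\<^bsub>A\<^esub> y (FObj K (Dom C f)) \<cdot>\<^bsub>A\<^esub> x (Dom C f)"
      by (simp add: A.Comp_assoc[symmetric] props ny)
    also have "\<dots> = FArr X3 (FArr L (FArr K f)) \<cdot>\<^bsub>A\<^esub> (y (FObj K (Dom C f)) \<cdot>\<^bsub>A\<^esub> x (Dom C f))"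
      by (simp add: A.Comp_assoc props)
    finally show ?thesis .
  qed
  then show ?thesis
    by (auto simp: is_nat_trans_def Hom_def comp_ftor_def Kc Kf xc yc A.Comp_in A.Dom_Comp A.Cod_Comp
        C.Dom_in C.Cod_in)
qed

lemma category_cEE:
  "abstract_cluster_structure_over E S \<Longrightarrow> category (cEE S)"
  by (auto simp: abstract_cluster_structure_over_def pair_loopfree_digraph_def
      intro: category_signed_path_cat)

lemma cluster_mor_arrows:
  assumes "is_cluster_mor S1 S2 m" "c \<in> Obj (cEE S1)"
  shows "FObj (mF m) c \<in> Obj (cEE S2)"
    and "mchi m c \<in> Hom Ab (FObj (cX S1) c) (FObj (cX S2) (FObj (mF m) c))"
    and "malpha m c \<in> Hom Ab (FObj (cA S1) c) (FObj (cA S2) (FObj (mF m) c))"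
  using assms by (auto simp: is_cluster_mor_def is_ftor_def is_nat_trans_def comp_ftor_def
      dest!: PiE_mem)

lemma cbeta_arrow:
  "abstract_cluster_structure_over E S \<Longrightarrow> c \<in> Obj (cEE S) \<Longrightarrow>
    cbeta S c \<in> Hom Ab (FObj (cX S) c) (FObj (cA S) c)"
  by (auto simp: abstract_cluster_structure_over_def is_factorization_def)

lemma is_cluster_mor_id:
  assumes S: "abstract_cluster_structure_over E S"
  shows "is_cluster_mor S S (id_cluster_mor S)"
proof -
  interpret Ab: category Ab by (rule category_Ab)
  interpret C: category "cEE S" using S by (rule category_cEE)
  have X: "is_ftor (op_cat (cEE S)) Ab (cX S)" and A: "is_ftor (cEE S) Ab (cA S)"
    using S by (auto simp: abstract_cluster_structure_over_def)
  have id: "id_ftor (op_cat (cEE S)) = id_ftor (cEE S)"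
    by (simp add: id_ftor_def)
  have "Ident Ab (FObj (cA S) c) \<cdot>\<^bsub>Ab\<^esub> cbeta S c = cbeta S c \<cdot>\<^bsub>Ab\<^esub> Ident Ab (FObj (cX S) c)"
    if "c \<in> Obj (cEE S)" for c
    using cbeta_arrow[OF S that] Ab.Comp_Ident[of "cbeta S c"] Ab.Ident_Comp[of "cbeta S c"]
    by (simp add: Hom_def)
  then show ?thesis
    using is_nat_trans_id[OF category_op_cat category_Ab X, OF C.category_axioms]
      is_nat_trans_id[OF C.category_axioms category_Ab A] is_ftor_id[OF C.category_axioms]
    by (auto simp: is_cluster_mor_def id_cluster_mor_def id) (simp add: id_ftor_def)
qed

lemma is_cluster_mor_comp:
  assumes S: "abstract_cluster_structure_over E1 S1" "abstract_cluster_structure_over E2 S2"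
      "abstract_cluster_structure_over E3 S3"
    and m: "is_cluster_mor S1 S2 m" and n: "is_cluster_mor S2 S3 n"
  shows "is_cluster_mor S1 S3 (comp_cluster_mor S1 n m)"
proof -
  interpret Ab: category Ab by (rule category_Ab)
  interpret C1: category "cEE S1" using S(1) by (rule category_cEE)
  have X: "is_ftor (op_cat (cEE S)) Ab (cX S)" and A: "is_ftor (cEE S) Ab (cA S)"
    if "abstract_cluster_structure_over E S" for E and S :: "('a, 'b) cluster_data"
    using that by (auto simp: abstract_cluster_structure_over_def)
  have F: "is_ftor (cEE S1) (cEE S2) (mF m)" "is_ftor (cEE S2) (cEE S3) (mF n)"
    using m n by (auto simp: is_cluster_mor_def)
  have "is_nat_trans (op_cat (cEE S1)) Ab (cX S1)
     (comp_ftor (op_cat (cEE S1)) (cX S3) (comp_ftor (op_cat (cEE S1)) (mF n) (mF m)))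
     (\<lambda>c \<in> Obj (op_cat (cEE S1)). mchi n (FObj (mF m) c) \<cdot>\<^bsub>Ab\<^esub> mchi m c)"
    by (rule is_nat_trans_comp[OF category_op_cat[OF C1.category_axioms] category_Ab
          is_ftor_op[OF F(1)] is_ftor_op[OF F(2)] X[OF S(1)] X[OF S(2)] X[OF S(3)]])
      (use m n in \<open>auto simp: is_cluster_mor_def\<close>)
  moreover have "is_nat_trans (cEE S1) Ab (cA S1)
     (comp_ftor (cEE S1) (cA S3) (comp_ftor (cEE S1) (mF n) (mF m)))
     (\<lambda>c \<in> Obj (cEE S1). malpha n (FObj (mF m) c) \<cdot>\<^bsub>Ab\<^esub> malpha m c)"
    by (rule is_nat_trans_comp[OF C1.category_axioms category_Ab F A[OF S(1)] A[OF S(2)] A[OF S(3)]])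
      (use m n in \<open>auto simp: is_cluster_mor_def\<close>)
  moreover have "malpha n (FObj (mF m) c) \<cdot>\<^bsub>Ab\<^esub> malpha m c \<cdot>\<^bsub>Ab\<^esub> cbeta S1 c =
      cbeta S3 (FObj (mF n) (FObj (mF m) c)) \<cdot>\<^bsub>Ab\<^esub> (mchi n (FObj (mF m) c) \<cdot>\<^bsub>Ab\<^esub> mchi m c)"
    if c: "c \<in> Obj (cEE S1)" for c
  proof -
    note mc = cluster_mor_arrows[OF m c]
    note nc = cluster_mor_arrows[OF n mc(1)]
    note arrows = mc(2,3) nc(2,3) cbeta_arrow[OF S(1) c] cbeta_arrow[OF S(2) mc(1)]
      cbeta_arrow[OF S(3) nc(1)]
    have "malpha m c \<cdot>\<^bsub>Ab\<^esub> cbeta S1 c = cbeta S2 (FObj (mF m) c) \<cdot>\<^bsub>Ab\<^esub> mchi m c"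
      using m c by (auto simp: is_cluster_mor_def)
    moreover have "malpha n (FObj (mF m) c) \<cdot>\<^bsub>Ab\<^esub> cbeta S2 (FObj (mF m) c) =
        cbeta S3 (FObj (mF n) (FObj (mF m) c)) \<cdot>\<^bsub>Ab\<^esub> mchi n (FObj (mF m) c)"
      using n mc(1) by (auto simp: is_cluster_mor_def)
    moreover have
      "malpha n (FObj (mF m) c) \<cdot>\<^bsub>Ab\<^esub> malpha m c \<cdot>\<^bsub>Ab\<^esub> cbeta S1 c =
        malpha n (FObj (mF m) c) \<cdot>\<^bsub>Ab\<^esub> (malpha m c \<cdot>\<^bsub>Ab\<^esub> cbeta S1 c)"
      "malpha n (FObj (mF m) c) \<cdot>\<^bsub>Ab\<^esub> cbeta S2 (FObj (mF m) c) \<cdot>\<^bsub>Ab\<^esub> mchi m c =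
        malpha n (FObj (mF m) c) \<cdot>\<^bsub>Ab\<^esub> (cbeta S2 (FObj (mF m) c) \<cdot>\<^bsub>Ab\<^esub> mchi m c)"
      "cbeta S3 (FObj (mF n) (FObj (mF m) c)) \<cdot>\<^bsub>Ab\<^esub> mchi n (FObj (mF m) c) \<cdot>\<^bsub>Ab\<^esub> mchi m c =
        cbeta S3 (FObj (mF n) (FObj (mF m) c)) \<cdot>\<^bsub>Ab\<^esub> (mchi n (FObj (mF m) c) \<cdot>\<^bsub>Ab\<^esub> mchi m c)"
      using arrows by (simp_all add: Hom_def Ab.Comp_assoc)
    ultimately show ?thesis by simp
  qed
  ultimately show ?thesis
    using is_ftor_comp[OF C1.category_axioms F]
    by (auto simp: is_cluster_mor_def comp_cluster_mor_def) (simp add: comp_ftor_def)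
qed

lemma cluster_mor_extensional:
  assumes "is_cluster_mor S1 S2 m"
  shows "FObj (mF m) \<in> extensional (Obj (cEE S1))" "FArr (mF m) \<in> extensional (Arr (cEE S1))"
    "mchi m \<in> extensional (Obj (cEE S1))" "malpha m \<in> extensional (Obj (cEE S1))"
  using assms by (auto simp: is_cluster_mor_def is_ftor_def is_nat_trans_def PiE_def)

lemma comp_cluster_mor_id:
  assumes S1: "abstract_cluster_structure_over E1 S1" and m: "is_cluster_mor S1 S2 m"
  shows "comp_cluster_mor S1 m (id_cluster_mor S1) = m"
    and "comp_cluster_mor S1 (id_cluster_mor S2) m = m"
proof -
  interpret Ab: category Ab by (rule category_Ab)
  note ext = cluster_mor_extensional[OF m]
  note mc = cluster_mor_arrows[OF m]
  have mf: "FArr (mF m) f \<in> Arr (cEE S2)" if "f \<in> Arr (cEE S1)" for f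
    using m that by (auto simp: is_cluster_mor_def is_ftor_def)
  have *: "g \<cdot>\<^bsub>Ab\<^esub> Ident Ab a = g" "Ident Ab b \<cdot>\<^bsub>Ab\<^esub> g = g" if "g \<in> Hom Ab a b" for a b g
    using that Ab.Comp_Ident[of g] Ab.Ident_Comp[of g] by (auto simp: Hom_def)
  have ext: "FObj (mF m) c = undefined" "mchi m c = undefined" "malpha m c = undefined"
    if "c \<notin> Obj (cEE S1)" for c
    using ext that by (auto simp: extensional_def)
  have extf: "FArr (mF m) f = undefined" if "f \<notin> Arr (cEE S1)" for f
    using cluster_mor_extensional(2)[OF m] that by (auto simp: extensional_def)
  show "comp_cluster_mor S1 m (id_cluster_mor S1) = m"
    by (intro cluster_mor.equality ftor.equality)
      (simp_all add: comp_cluster_mor_def id_cluster_mor_def comp_ftor_def id_ftor_def fun_eq_iff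
        ext extf *[OF mc(2)] *[OF mc(3)])
  show "comp_cluster_mor S1 (id_cluster_mor S2) m = m"
    by (intro cluster_mor.equality ftor.equality)
      (simp_all add: comp_cluster_mor_def id_cluster_mor_def comp_ftor_def id_ftor_def fun_eq_iff
        ext extf mf mc(1) *[OF mc(2)] *[OF mc(3)])
qed

lemma comp_cluster_mor_assoc:
  assumes m: "is_cluster_mor S1 S2 m" and n: "is_cluster_mor S2 S3 n" and k: "is_cluster_mor S3 S4 k"
  shows "comp_cluster_mor S1 (comp_cluster_mor S2 k n) m = comp_cluster_mor S1 k (comp_cluster_mor S1 n m)"
proof -
  interpret Ab: category Ab by (rule category_Ab)
  have mf: "FArr (mF m) f \<in> Arr (cEE S2)" if "f \<in> Arr (cEE S1)" for f
    using m that by (auto simp: is_cluster_mor_def is_ftor_def)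
  have *: "h \<cdot>\<^bsub>Ab\<^esub> g \<cdot>\<^bsub>Ab\<^esub> f = h \<cdot>\<^bsub>Ab\<^esub> (g \<cdot>\<^bsub>Ab\<^esub> f)"
    if "f \<in> Hom Ab a b" "g \<in> Hom Ab b c" "h \<in> Hom Ab c d" for a b c d f g h
    using that by (auto simp: Hom_def Ab.Comp_assoc)
  note mc = cluster_mor_arrows[OF m]
  note nc = cluster_mor_arrows[OF n mc(1)]
  note kc = cluster_mor_arrows[OF k nc(1)]
  show ?thesis
    by (auto simp: comp_cluster_mor_def comp_ftor_def fun_eq_iff mc(1) mf
        *[OF mc(2) nc(2) kc(2)] *[OF mc(3) nc(3) kc(3)])
qed

lemma category_ACS: "category ACS"
  by unfold_locales
    (auto simp: ACS_def comp_cluster_mor_id comp_cluster_mor_assoc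
      intro: is_cluster_mor_id is_cluster_mor_comp)

end

theory Submission
  imports Defs
begin

text \<open>The zero group is terminal in \<^const>\<open>Ab\<close>, so there is exactly one natural transformation
  into a constant functor at it, and the square relating the factorizations commutes because its
  corner is terminal.\<close>

text \<open>Freeness on the empty set is what makes constant functors at \<open>zero_group\<close>
  free abelian sheaves; commutativity is inherited as well.\<close>

lemma zero_group_eq_free: "zero_group = free_Abelian_group {}"
  by (simp add: zero_group_def free_Abelian_group_def)

lemma comm_group_zero_group: "comm_group zero_group"
  by (simp add: zero_group_eq_free abelian_free_Abelian_group)

text \<open>Every homomorphism into a one-element group is constant at the unit. Arrows of
  \<open>Ab\<close> are extensional, so agreement on \<open>carrier H\<close> already gives equality
  of the triples.\<close>

lemma terminal_object_Ab:
  assumes G: "comm_group G" and one: "carrier G = {\<one>\<^bsub>G\<^esub>}"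
  shows "terminal_object Ab G"
proof -
  interpret G: comm_group G by fact
  have "\<exists>!f. f \<in> Hom Ab H G" if H: "comm_group H" for H
  proof
    show "(H, \<lambda>x \<in> carrier H. \<one>\<^bsub>G\<^esub>, G) \<in> Hom Ab H G"
      using H G by (auto simp: Hom_def Ab_def hom_def comm_group_def group_def monoid.m_closed)
  next
    fix f
    assume "f \<in> Hom Ab H G"
    then obtain h where h: "f = (H, h, G)" "h \<in> hom H G" "h \<in> extensional (carrier H)"
      by (auto simp: Hom_def Ab_def)
    have "h = (\<lambda>x \<in> carrier H. \<one>\<^bsub>G\<^esub>)"
      by (rule extensionalityI[OF h(3)]) (use h(2) one in \<open>auto simp: hom_def Pi_iff\<close>)
    then show "f = (H, \<lambda>x \<in> carrier H. \<one>\<^bsub>G\<^esub>, G)"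
      by (simp add: h(1))
  qed
  with G show ?thesis
    by (simp add: terminal_object_def) (simp add: Ab_def)
qed

lemma terminal_object_zero_group: "terminal_object Ab zero_group"
  by (rule terminal_object_Ab[OF comm_group_zero_group]) (simp add: zero_group_def)

lemma terminal_object_unique:
  "terminal_object C t \<Longrightarrow> a \<in> Obj C \<Longrightarrow> f \<in> Hom C a t \<Longrightarrow> g \<in> Hom C a t \<Longrightarrow> f = g"
  by (auto simp: terminal_object_def)

lemma is_ftor_const:
  assumes "category C" "category D" "d \<in> Obj D"
  shows "is_ftor C D (const_ftor C D d)"
proof -
  interpret C: category C by fact
  interpret D: category D by fact
  show ?thesis
    using assms(3) D.Comp_Ident[OF D.Ident_in[OF assms(3)]]
    by (auto simp: is_ftor_def const_ftor_def C.Dom_in C.Cod_in C.Ident_in C.Comp_in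
        D.Ident_in D.Dom_Ident D.Cod_Ident)
qed

text \<open>The underlying Set-valued functor is the constant one at \<open>S\<close>. On arrows the
  two sides agree because \<open>Free_ftor\<close> preserves the identity of
  \<open>S\<close>.\<close>

lemma free_abelian_sheaf_const:
  assumes "category C"
  shows "free_abelian_sheaf C (const_ftor C Ab (free_Abelian_group S))"
proof -
  have S: "S \<in> Obj Set_cat"
    by (simp add: Set_cat_def)
  have "FArr Free_ftor (Ident Set_cat S) = Ident Ab (FObj Free_ftor S)"
    using is_ftor_Free S unfolding is_ftor_def by blast
  then have "const_ftor C Ab (free_Abelian_group S) = comp_ftor C Free_ftor (const_ftor C Set_cat S)"
    by (simp add: comp_ftor_def const_ftor_def fun_eq_iff) (simp add: Free_ftor_def)
  then show ?thesis
    using is_ftor_const[OF assms category_Set_cat S] by (auto simp: free_abelian_sheaf_def)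
qed

text \<open>The only arrow \<open>a\<close> has to be the identity of \<open>d\<close>, so each
  functor agrees with the constant one on \<open>C\<close>; outside \<open>C\<close> both are
  \<open>undefined\<close>.\<close>

lemma unique_ftor_to_point:
  assumes "category C" "category D" "Obj D = {d}" "Arr D = {a}"
  shows "\<exists>!F. is_ftor C D F"
proof
  show "is_ftor C D (const_ftor C D d)"
    using assms by (simp add: is_ftor_const)
  have "Ident D d = a"
    using category.Ident_in[OF assms(2), of d] assms(3,4) by simp
  then show "F = const_ftor C D d" if "is_ftor C D F" for F
    using that assms(3,4)
    by (intro ftor.equality ext) (auto simp: is_ftor_def const_ftor_def PiE_iff extensional_def)
qed

text \<open>Each component is forced by terminality of its target, and naturality comes for free,
  since both sides of each square end in a terminal object.\<close>

lemma unique_nat_trans_to_terminal: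
  assumes "category C" "category D" and F: "is_ftor C D F" and G: "is_ftor C D G"
    and terminal: "\<And>c. c \<in> Obj C \<Longrightarrow> terminal_object D (FObj G c)"
  shows "\<exists>!\<eta>. is_nat_trans C D F G \<eta>"
proof
  interpret C: category C by fact
  interpret D: category D by fact
  have Fc: "FObj F c \<in> Obj D" if "c \<in> Obj C" for c
    using F that by (auto simp: is_ftor_def)
  \<comment> \<open>The description picks the only available component; the restriction to
    \<open>Obj C\<close> supplies the extensionality demanded of families.\<close>
  define \<eta> where "\<eta> = (\<lambda>c \<in> Obj C. THE h. h \<in> Hom D (FObj F c) (FObj G c))"
  have \<eta>: "\<eta> c \<in> Hom D (FObj F c) (FObj G c)" if "c \<in> Obj C" for c
  proof -
    have "\<exists>!h. h \<in> Hom D (FObj F c) (FObj G c)"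
      using terminal[OF that] Fc[OF that] by (simp add: terminal_object_def)
    from theI'[OF this] show ?thesis
      using that by (simp add: \<eta>_def)
  qed
  have "\<eta> (Cod C f) \<cdot>\<^bsub>D\<^esub> FArr F f = FArr G f \<cdot>\<^bsub>D\<^esub> \<eta> (Dom C f)" if f: "f \<in> Arr C" for f
  proof (rule terminal_object_unique)
    show "terminal_object D (FObj G (Cod C f))" "FObj F (Dom C f) \<in> Obj D"
      using f by (simp_all add: terminal Fc C.Cod_in C.Dom_in)
    have "FArr F f \<in> Hom D (FObj F (Dom C f)) (FObj F (Cod C f))"
        "FArr G f \<in> Hom D (FObj G (Dom C f)) (FObj G (Cod C f))"
      using F G f by (auto simp: is_ftor_def Hom_def)
    with \<eta>[OF C.Dom_in[OF f]] \<eta>[OF C.Cod_in[OF f]]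
    show "\<eta> (Cod C f) \<cdot>\<^bsub>D\<^esub> FArr F f \<in> Hom D (FObj F (Dom C f)) (FObj G (Cod C f))"
        "FArr G f \<cdot>\<^bsub>D\<^esub> \<eta> (Dom C f) \<in> Hom D (FObj F (Dom C f)) (FObj G (Cod C f))"
      by (auto simp: Hom_def D.Comp_in D.Dom_Comp D.Cod_Comp)
  qed
  then show "is_nat_trans C D F G \<eta>"
    using \<eta> by (auto simp: is_nat_trans_def) (simp add: \<eta>_def)
  show "\<eta>' = \<eta>" if \<eta>': "is_nat_trans C D F G \<eta>'" for \<eta>'
  proof (rule extensionalityI[of _ "Obj C"])
    fix c
    assume c: "c \<in> Obj C"
    show "\<eta>' c = \<eta> c"
      by (rule terminal_object_unique[OF terminal[OF c] Fc[OF c] _ \<eta>[OF c]])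
        (use \<eta>' c in \<open>auto simp: is_nat_trans_def\<close>)
  qed (use \<eta>' in \<open>auto simp: is_nat_trans_def \<eta>_def PiE_def\<close>)
qed

lemma pair_loopfree_digraph_point_graph: "pair_loopfree_digraph (point_graph v)"
  by unfold_locales (auto simp: point_graph_def)

lemma category_point: "category (signed_path_cat (point_graph v))"
  using pair_loopfree_digraph_point_graph[of v]
  by (auto simp: pair_loopfree_digraph_def intro: category_signed_path_cat)

lemma trivial_cluster_structure_simps [simp]:
  "cEE (trivial_cluster_structure v) = signed_path_cat (point_graph v)"
  "cX (trivial_cluster_structure v) =
    const_ftor (op_cat (signed_path_cat (point_graph v))) Ab zero_group"
  "cbeta (trivial_cluster_structure v) = (\<lambda>c \<in> {v}. Ident Ab zero_group)"
  "cA (trivial_cluster_structure v) =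
    const_ftor (signed_path_cat (point_graph v)) Ab zero_group"
  "cpair (trivial_cluster_structure v) = (\<lambda>c \<in> {v}. \<lambda>x \<in> {0} \<times> {0}. 0)"
  by (simp_all add: trivial_cluster_structure_def Let_def)

text \<open>All arrows start and end at \<open>v\<close>, and both functors send them to the
  identity of the zero group, so every condition reduces to one about that identity or about the
  element 0.\<close>

lemma abstract_cluster_structure_trivial:
  fixes v :: 'v
  shows "abstract_cluster_structure_over (point_graph v)
    (trivial_cluster_structure v :: ('v, 'b) cluster_data)"
proof -
  let ?C = "signed_path_cat (point_graph v)" and ?Z = "zero_group :: ('b \<Rightarrow>\<^sub>0 int) monoid"
  interpret C: category ?C by (rule category_point)
  interpret Ab: category "Ab :: (('b \<Rightarrow>\<^sub>0 int) monoid, ('b \<Rightarrow>\<^sub>0 int) ab_arr) precategory"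
    by (rule category_Ab)
  note obj = signed_path_cat_point_graph(1)[of v]
  have Z: "?Z \<in> Obj Ab"
    by (simp add: Ab_def comm_group_zero_group)
  have ftor: "is_ftor ?C Ab (const_ftor ?C Ab ?Z)"
    "is_ftor (op_cat ?C) Ab (const_ftor (op_cat ?C) Ab ?Z)"
    using Z by (simp_all add: is_ftor_const category_op_cat C.category_axioms Ab.category_axioms)
  have ends: "Dom ?C f = v" "Cod ?C f = v" if "f \<in> Arr ?C" for f
    using C.Dom_in[OF that] C.Cod_in[OF that] obj by auto
  \<comment> \<open>Both sides of the dinaturality equation thereby become the pairing of 0 with
    0.\<close>
  have fn: "fn (Ident Ab ?Z) x = 0" if "x \<in> carrier ?Z" for x
    using that by (simp add: Ab_def fn_def zero_group_def)
  \<comment> \<open>With all arrows sent to the identity, the factorization equation says only that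
    the identity composed with itself is the identity.\<close>
  have "Ident Ab ?Z \<cdot>\<^bsub>Ab\<^esub> Ident Ab ?Z = Ident Ab ?Z"
    using Ab.Comp_Ident[OF Ab.Ident_in[OF Z]] Ab.Dom_Ident[OF Z] by simp
  then have "is_factorization ?C (const_ftor (op_cat ?C) Ab ?Z) (const_ftor ?C Ab ?Z)
      (\<lambda>c \<in> {v}. Ident Ab ?Z)"
    using Z by (auto simp: is_factorization_def obj const_ftor_def Hom_def ends
        Ab.Ident_in Ab.Dom_Ident Ab.Cod_Ident)
  moreover have "is_pairing ?C (const_ftor ?C Ab ?Z) (const_ftor (op_cat ?C) Ab ?Z)
      (\<lambda>c \<in> {v}. \<lambda>x \<in> {0} \<times> {0}. 0)"
    unfolding is_pairing_def using ftor
    by (auto simp: obj const_ftor_def Hom_def ends fn)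
       (auto simp: zero_group_def hom_def)
  \<comment> \<open>Any map on the singleton {0} is injective.\<close>
  moreover have "right_nondegenerate ?C (const_ftor ?C Ab ?Z) (const_ftor (op_cat ?C) Ab ?Z)
      (\<lambda>c \<in> {v}. \<lambda>x \<in> {0} \<times> {0}. 0)"
    by (simp add: right_nondegenerate_def obj const_ftor_def zero_group_def)
  moreover have "free_abelian_sheaf ?C (const_ftor ?C Ab ?Z)"
    "free_abelian_sheaf (op_cat ?C) (const_ftor (op_cat ?C) Ab ?Z)"
    unfolding zero_group_eq_free
    by (simp_all add: free_abelian_sheaf_const category_op_cat C.category_axioms)
  ultimately show ?thesis
    using ftor pair_loopfree_digraph_point_graph
    by (simp add: abstract_cluster_structure_over_def)
qed

text \<open>The functor is determined first, because the targets of the other two components depend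
  on it; each of these is then unique by terminality of the zero group.\<close>

lemma unique_cluster_mor_to_trivial:
  fixes S :: "('v, 'b) cluster_data"
  assumes S: "abstract_cluster_structure_over E S"
  shows "\<exists>!m. is_cluster_mor S (trivial_cluster_structure v) m"
proof -
  let ?P = "signed_path_cat (point_graph v)" and ?T = "trivial_cluster_structure v :: ('v, 'b) cluster_data"
  interpret C: category "cEE S" using S by (rule category_cEE)
  have S': "is_ftor (op_cat (cEE S)) Ab (cX S)" "is_ftor (cEE S) Ab (cA S)"
    using S by (auto simp: abstract_cluster_structure_over_def)
  have T: "is_ftor (op_cat ?P) Ab (cX ?T)" "is_ftor ?P Ab (cA ?T)"
    using abstract_cluster_structure_trivial[of v, where 'b = 'b]
    by (auto simp: abstract_cluster_structure_over_def)
  obtain a where "Arr ?P = {a}"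
    using signed_path_cat_point_graph(2)[of v] by (rule exE)
  then have ex1_F: "\<exists>!F. is_ftor (cEE S) ?P F"
    by (rule unique_ftor_to_point[OF C.category_axioms category_point signed_path_cat_point_graph(1)])
  then obtain F where F: "is_ftor (cEE S) ?P F"
    by (rule ex1_implies_ex[THEN exE])
  \<comment> \<open>The constant functors and \<open>cbeta ?T\<close> have their intended values
    only at \<open>v\<close>, so this is what identifies the targets with
    \<open>zero_group\<close>.\<close>
  have Fc: "FObj F c = v" if "c \<in> Obj (cEE S)" for c
    using F that signed_path_cat_point_graph(1)[of v] by (auto simp: is_ftor_def)
  have ex1_\<chi>: "\<exists>!\<chi>. is_nat_trans (op_cat (cEE S)) Ab (cX S) (comp_ftor (op_cat (cEE S)) (cX ?T) F) \<chi>"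
  proof (rule unique_nat_trans_to_terminal)
    show "is_ftor (op_cat (cEE S)) Ab (comp_ftor (op_cat (cEE S)) (cX ?T) F)"
      by (rule is_ftor_comp[OF _ is_ftor_op[OF F] T(1)]) (rule category_op_cat[OF C.category_axioms])
  qed (use S' in \<open>auto simp: category_op_cat C.category_axioms category_Ab comp_ftor_def const_ftor_def
        Fc signed_path_cat_point_graph(1) terminal_object_zero_group\<close>)
  then obtain \<chi> where \<chi>:
      "is_nat_trans (op_cat (cEE S)) Ab (cX S) (comp_ftor (op_cat (cEE S)) (cX ?T) F) \<chi>"
    by (rule ex1_implies_ex[THEN exE])
  have ex1_\<alpha>: "\<exists>!\<alpha>. is_nat_trans (cEE S) Ab (cA S) (comp_ftor (cEE S) (cA ?T) F) \<alpha>"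
  proof (rule unique_nat_trans_to_terminal)
    show "is_ftor (cEE S) Ab (comp_ftor (cEE S) (cA ?T) F)"
      by (rule is_ftor_comp[OF C.category_axioms F T(2)])
  qed (use S' in \<open>auto simp: C.category_axioms category_Ab comp_ftor_def const_ftor_def
        Fc signed_path_cat_point_graph(1) terminal_object_zero_group\<close>)
  then obtain \<alpha> where \<alpha>: "is_nat_trans (cEE S) Ab (cA S) (comp_ftor (cEE S) (cA ?T) F) \<alpha>"
    by (rule ex1_implies_ex[THEN exE])
  \<comment> \<open>Both composites are arrows from the group \<open>FObj (cX S) c\<close> to the
    terminal \<open>zero_group\<close>, hence equal.\<close>
  have square: "\<alpha> c \<cdot>\<^bsub>Ab\<^esub> cbeta S c = cbeta ?T (FObj F c) \<cdot>\<^bsub>Ab\<^esub> \<chi> c" if c: "c \<in> Obj (cEE S)" for c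
  proof (rule terminal_object_unique[OF terminal_object_zero_group])
    interpret Ab: category "Ab :: (('b \<Rightarrow>\<^sub>0 int) monoid, ('b \<Rightarrow>\<^sub>0 int) ab_arr) precategory"
      by (rule category_Ab)
    show "FObj (cX S) c \<in> Obj Ab"
      using S'(1) c by (auto simp: is_ftor_def)
    have "FObj (comp_ftor (op_cat (cEE S)) (cX ?T) F) c = zero_group"
      "FObj (comp_ftor (cEE S) (cA ?T) F) c = zero_group"
      using c by (simp_all add: comp_ftor_def const_ftor_def Fc signed_path_cat_point_graph(1))
    then have "\<chi> c \<in> Hom Ab (FObj (cX S) c) zero_group" "\<alpha> c \<in> Hom Ab (FObj (cA S) c) zero_group"
      using PiE_mem[OF conjunct1[OF \<chi>[unfolded is_nat_trans_def]], of c]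
        PiE_mem[OF conjunct1[OF \<alpha>[unfolded is_nat_trans_def]], of c] c by simp_all
    moreover have "cbeta ?T (FObj F c) \<in> Hom Ab zero_group zero_group"
      using terminal_object_zero_group[where 'a = 'b]
      by (simp add: terminal_object_def Fc c Hom_def Ab.Ident_in Ab.Dom_Ident Ab.Cod_Ident)
    ultimately show "\<alpha> c \<cdot>\<^bsub>Ab\<^esub> cbeta S c \<in> Hom Ab (FObj (cX S) c) zero_group"
        "cbeta ?T (FObj F c) \<cdot>\<^bsub>Ab\<^esub> \<chi> c \<in> Hom Ab (FObj (cX S) c) zero_group"
      using cbeta_arrow[OF S c] by (simp_all add: Hom_def Ab.Comp_in Ab.Dom_Comp Ab.Cod_Comp)
  qed
  show ?thesis
  proof
    show "is_cluster_mor S ?T \<lparr>mF = F, mchi = \<chi>, malpha = \<alpha>\<rparr>"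
      using F \<chi> \<alpha> square by (simp add: is_cluster_mor_def)
  next
    fix m
    assume m: "is_cluster_mor S ?T m"
    then have "is_ftor (cEE S) ?P (mF m)"
      and nat: "is_nat_trans (op_cat (cEE S)) Ab (cX S) (comp_ftor (op_cat (cEE S)) (cX ?T) (mF m)) (mchi m)"
        "is_nat_trans (cEE S) Ab (cA S) (comp_ftor (cEE S) (cA ?T) (mF m)) (malpha m)"
      by (simp_all only: is_cluster_mor_def trivial_cluster_structure_simps)
    \<comment> \<open>The conditions in \<open>nat\<close> mention \<open>mF m\<close>; only after
      replacing it by \<open>F\<close> do they fall under the uniqueness of \<chi> and
      \<alpha>.\<close>
    then have mF: "mF m = F"
      using F ex1_F by blast
    moreover have "mchi m = \<chi>" "malpha m = \<alpha>"
      using nat[unfolded mF] \<chi> ex1_\<chi> \<alpha> ex1_\<alpha> by blast+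
    ultimately show "m = \<lparr>mF = F, mchi = \<chi>, malpha = \<alpha>\<rparr>"
      by simp
  qed
qed

theorem proposition3p11:
  fixes v :: 'v
  shows "terminal_object (ACS :: (('v, 'b) cluster_data,
      ('v, 'b) cluster_data \<times> ('v, 'b) cluster_mor \<times> ('v, 'b) cluster_data) precategory)
    (trivial_cluster_structure v)"
proof -
  let ?T = "trivial_cluster_structure v :: ('v, 'b) cluster_data"
  have T: "\<exists>E. abstract_cluster_structure_over E ?T"
    using abstract_cluster_structure_trivial by (rule exI)
  have "\<exists>!f. f \<in> Hom ACS S ?T" if S: "\<exists>E. abstract_cluster_structure_over E S" for S
  proof -
    have ex1: "\<exists>!m. is_cluster_mor S ?T m"
      using S by (elim exE) (rule unique_cluster_mor_to_trivial)
    \<comment> \<open>Arrows of \<open>ACS\<close> carry their end points, so with these fixed they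
      correspond exactly to cluster morphisms and uniqueness transfers.\<close>
    have "f \<in> Hom ACS S ?T \<longleftrightarrow> (\<exists>m. f = (S, m, ?T) \<and> is_cluster_mor S ?T m)" for f
      using S T by (auto simp: Hom_def ACS_def simp del: trivial_cluster_structure_simps)
    with ex1 show ?thesis by auto
  qed
  with T show ?thesis
    by (simp add: terminal_object_def) (simp add: ACS_def)
qed

end
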